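(* Let $(\mathcal{R},\boxplus,\boxtimes,\zeta)$ be a proximal ring and let $\mathcal{F}\subseteq\mathcal{R}$ be a closed set. Then for every $\varepsilon\in\mathcal{R}$ the set $\varepsilon\boxplus\mathcal{F}=\{\varepsilon\boxplus f : f\in\mathcal{F}\}$ is also closed.
   Context: A ring is associative, not necessarily commutative or unital; $\boxplus$ is its addition and $\boxtimes$ its multiplication. A proximity space $(\mathfrak{X},\zeta)$ is a nonempty set $\mathfrak{X}$ with a (Čech) proximity: a relation $\zeta$ on subsets of $\mathfrak{X}$ ("near") such that, for all $A,B,C\subseteq\mathfrak{X}$: $A\,\zeta\,B$ implies $B\,\zeta\,A$; $A\,\zeta\,B$ implies $A,B\neq\emptyset$; $A\cap B\neq\emptyset$ implies $A\,\zeta\,B$; and $A\,\zeta\,(B\cup C)$ if and only if $A\,\zeta\,B$ or $A\,\zeta\,C$. The closure of $A\subseteq\mathfrak{X}$ is $\mathrm{cl}_\zeta(A)=\{x\in\mathfrak{X} : \{x\}\,\zeta\,A\}$, and $A$ is closed if $\mathrm{cl}_\zeta(A)=A$. A map $f$ between proximity spaces is proximally continuous if $W$ near $K$ implies $f(W)$ near $f(K)$ for all subsets $W,K$ of its domain. The product of two proximity spaces carries the product proximity: $A$ is near $B$ if and only if for all finite decompositions $A=A_1\cup\dots\cup A_m$ and $B=B_1\cup\dots\cup B_n$ there are $i,j$ such that, for each coordinate projection $p$, $p(A_i)$ is near $p(B_j)$. (On rectangles: $W_1\times W_2$ is near $K_1\times K_2$ if and only if $W_1$ is near $K_1$ and $W_2$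 is near $K_2$.) A proximal ring $(\mathcal{R},\boxplus,\boxtimes,\zeta)$ is a ring with a proximity $\zeta$ such that addition $(w_0,w_1)\mapsto w_0\boxplus w_1$ and multiplication $(w_0,w_1)\mapsto w_0\boxtimes w_1$, as maps $\mathcal{R}\times\mathcal{R}\to\mathcal{R}$, and additive inversion $w\mapsto -w$, as a map $\mathcal{R}\to\mathcal{R}$, are proximally continuous. *)

theory Defs
  imports Main
begin

text \<open>A Cech proximity on the type \<open>'a\<close>; nonemptiness of the space is automatic for a type.\<close>

locale proximity =
  fixes \<zeta> :: "'a set \<Rightarrow> 'a set \<Rightarrow> bool"
  assumes near_sym: "\<zeta> A B \<Longrightarrow> \<zeta> B A"
    and near_nonempty: "\<zeta> A B \<Longrightarrow> A \<noteq> {} \<and> B \<noteq> {}"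
    and near_if_meet: "A \<inter> B \<noteq> {} \<Longrightarrow> \<zeta> A B"
    and near_Un_iff: "\<zeta> A (B \<union> C) \<longleftrightarrow> \<zeta> A B \<or> \<zeta> A C"

definition prox_cl :: "('a set \<Rightarrow> 'a set \<Rightarrow> bool) \<Rightarrow> 'a set \<Rightarrow> 'a set" where
  "prox_cl \<zeta> A = {x. \<zeta> {x} A}"

definition prox_closed :: "('a set \<Rightarrow> 'a set \<Rightarrow> bool) \<Rightarrow> 'a set \<Rightarrow> bool" where
  "prox_closed \<zeta> A \<longleftrightarrow> prox_cl \<zeta> A = A"

definition prox_continuous ::
  "('a set \<Rightarrow> 'a set \<Rightarrow> bool) \<Rightarrow> ('b set \<Rightarrow> 'b set \<Rightarrow> bool) \<Rightarrow> ('a \<Rightarrow> 'b) \<Rightarrow> bool" where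
  "prox_continuous \<zeta> \<xi> f \<longleftrightarrow> (\<forall>W K. \<zeta> W K \<longrightarrow> \<xi> (f ` W) (f ` K))"

text \<open>
  A finite decomposition is a finite family of sets with the given union. The empty family
  decomposes only the empty set; since the empty set is near nothing, it makes no difference
  whether that family is admitted.
\<close>

definition prod_prox ::
  "('a set \<Rightarrow> 'a set \<Rightarrow> bool) \<Rightarrow> ('b set \<Rightarrow> 'b set \<Rightarrow> bool) \<Rightarrow>
    ('a \<times> 'b) set \<Rightarrow> ('a \<times> 'b) set \<Rightarrow> bool" where
  "prod_prox \<zeta> \<xi> A B \<longleftrightarrow>
    (\<forall>\<A> \<B>. finite \<A> \<and> finite \<B> \<and> A = \<Union>\<A> \<and> B = \<Union>\<B> \<longrightarrow>
      (\<exists>P\<in>\<A>. \<exists>Q\<in>\<B>. \<zeta> (fst ` P) (fst ` Q) \<and> \<xi> (snd ` P) (snd ` Q)))"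

text \<open>The class \<open>ring\<close> requires neither commutative multiplication nor a unit.\<close>

locale proximal_ring = proximity \<zeta>
  for \<zeta> :: "'a::ring set \<Rightarrow> 'a set \<Rightarrow> bool" +
  assumes add_prox_continuous: "prox_continuous (prod_prox \<zeta> \<zeta>) \<zeta> (\<lambda>(v, w). v + w)"
    and mult_prox_continuous: "prox_continuous (prod_prox \<zeta> \<zeta>) \<zeta> (\<lambda>(v, w). v * w)"
    and uminus_prox_continuous: "prox_continuous \<zeta> \<zeta> (\<lambda>w. - w)"

end

theory Submission
  imports Defs
begin

text \<open>
  A left translation \<open>w \<mapsto> a + w\<close> is proximally continuous: it is the embedding \<open>w \<mapsto> (a, w)\<close>
  of a factor as a slice of the product, followed by addition. Its inverse is the translation by
  \<open>- a\<close>, so translations are proximal isomorphisms and therefore preserve closed sets. Concretely,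
  a point \<open>x\<close> near \<open>\<epsilon> + F\<close> is carried by the translation by \<open>- \<epsilon>\<close> to a point near \<open>F\<close>, hence to
  a point of \<open>F\<close>.

  The real content is the continuity of the slice embedding (\<open>prox_continuous_slice\<close>), which
  has to confront all finite decompositions in the product proximity. A decomposition of a slice
  projects to a decomposition of the second factor, where additivity of nearness selects a pair of
  near pieces (\<open>near_finite_UnionsE\<close>).
\<close>

context proximity
begin

lemma near_finite_UnionE:
  assumes "finite \<B>" and "\<zeta> A (\<Union>\<B>)"
  obtains Q where "Q \<in> \<B>" and "\<zeta> A Q"
proof -
  have "\<exists>Q\<in>\<B>. \<zeta> A Q"
    using assms
  proof (induction \<B> rule: finite_induct)
    case empty
    then show ?case by (simp, blast dest: near_nonempty)
  next
    case (insert Q \<B>)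
    then show ?case by (auto simp: near_Un_iff)
  qed
  then show thesis using that by blast
qed

lemma near_finite_UnionsE:
  assumes "finite \<A>" and "finite \<B>" and "\<zeta> (\<Union>\<A>) (\<Union>\<B>)"
  obtains P Q where "P \<in> \<A>" and "Q \<in> \<B>" and "\<zeta> P Q"
proof -
  obtain Q where Q: "Q \<in> \<B>" "\<zeta> (\<Union>\<A>) Q"
    using near_finite_UnionE[OF assms(2,3)] .
  obtain P where "P \<in> \<A>" "\<zeta> Q P"
    using near_finite_UnionE[OF assms(1) near_sym[OF Q(2)]] .
  then show thesis using that Q(1) near_sym by blast
qed

end

text \<open>
  Every nonempty piece of a slice \<open>{a} \<times> W\<close> has first projection exactly \<open>{a}\<close>, so the first
  coordinate imposes no condition on a pair of pieces whose second projections are near.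
\<close>

lemma prox_continuous_slice:
  assumes "proximity \<zeta>" and "proximity \<xi>"
  shows "prox_continuous \<xi> (prod_prox \<zeta> \<xi>) (Pair a)"
  unfolding prox_continuous_def prod_prox_def
proof (intro allI impI, elim conjE)
  fix W K \<A> \<B>
  assume near: "\<xi> W K" and fin: "finite \<A>" "finite \<B>"
    and W: "Pair a ` W = \<Union>\<A>" and K: "Pair a ` K = \<Union>\<B>"
  have "\<xi> (snd ` Pair a ` W) (snd ` Pair a ` K)"
    using near by (simp add: image_image)
  then have "\<xi> (\<Union> ((`) snd ` \<A>)) (\<Union> ((`) snd ` \<B>))"
    by (simp only: W K image_Union)
  then obtain P Q where PQ: "P \<in> \<A>" "Q \<in> \<B>" and snd_near: "\<xi> (snd ` P) (snd ` Q)"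
    using proximity.near_finite_UnionsE[OF assms(2), of "(`) snd ` \<A>" "(`) snd ` \<B>"] fin
    by blast
  have "P \<noteq> {}" "Q \<noteq> {}"
    using proximity.near_nonempty[OF assms(2) snd_near] by auto
  moreover have "P \<subseteq> Pair a ` W" "Q \<subseteq> Pair a ` K"
    using PQ W K by auto
  ultimately have "a \<in> fst ` P \<inter> fst ` Q"
    by force
  then have "fst ` P \<inter> fst ` Q \<noteq> {}"
    by (metis empty_iff)
  then have "\<zeta> (fst ` P) (fst ` Q)"
    by (rule proximity.near_if_meet[OF assms(1)])
  then show "\<exists>P\<in>\<A>. \<exists>Q\<in>\<B>. \<zeta> (fst ` P) (fst ` Q) \<and> \<xi> (snd ` P) (snd ` Q)"
    using PQ snd_near by blast
qed

lemma (in proximal_ring) prox_continuous_translation: "prox_continuous \<zeta> \<zeta> ((+) a)"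
  unfolding prox_continuous_def
proof (intro allI impI)
  fix W K
  assume "\<zeta> W K"
  then have "prod_prox \<zeta> \<zeta> (Pair a ` W) (Pair a ` K)"
    using prox_continuous_slice[OF proximity_axioms proximity_axioms]
    by (simp add: prox_continuous_def)
  then have "\<zeta> ((\<lambda>(v, w). v + w) ` Pair a ` W) ((\<lambda>(v, w). v + w) ` Pair a ` K)"
    using add_prox_continuous by (simp add: prox_continuous_def)
  then show "\<zeta> ((+) a ` W) ((+) a ` K)"
    by (simp add: image_image)
qed

lemma (in proximity) prox_closedI:
  assumes "\<And>x. \<zeta> {x} A \<Longrightarrow> x \<in> A"
  shows "prox_closed \<zeta> A"
  using assms near_if_meet unfolding prox_closed_def prox_cl_def by blast

theorem proposition3:
  fixes \<zeta> :: "'a::ring set \<Rightarrow> 'a set \<Rightarrow> bool"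
    and F :: "'a set"
    and \<epsilon> :: 'a
  assumes "proximal_ring \<zeta>"
    and "prox_closed \<zeta> F"
  shows "prox_closed \<zeta> {\<epsilon> + f | f. f \<in> F}"
proof -
  interpret proximal_ring \<zeta> by fact
  have translate: "{\<epsilon> + f | f. f \<in> F} = (+) \<epsilon> ` F"
    by blast
  show ?thesis
    unfolding translate
  proof (rule prox_closedI)
    fix x
    assume "\<zeta> {x} ((+) \<epsilon> ` F)"
    then have "\<zeta> ((+) (- \<epsilon>) ` {x}) ((+) (- \<epsilon>) ` (+) \<epsilon> ` F)"
      using prox_continuous_translation unfolding prox_continuous_def by blast
    then have "\<zeta> {- \<epsilon> + x} F"
      by (simp add: image_image)
    then have "- \<epsilon> + x \<in> F"
      using assms(2) unfolding prox_closed_def prox_cl_def by blast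
    then have "\<epsilon> + (- \<epsilon> + x) \<in> (+) \<epsilon> ` F"
      by (rule imageI)
    then show "x \<in> (+) \<epsilon> ` F"
      by simp
  qed
qed

end
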